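(* Let $m\ge 0$ be an integer and let $G$ be a triangle-free graph on $n$ vertices. Let $c$ be an edge coloring of $G$ with total color degree $\hat d(G)>2mn$. Then $G$ contains a rainbow matching (with respect to $c$) of size $m+1$.
   Context: All graphs are finite and simple. An edge coloring of $G$ is any assignment $c:E(G)\to[r]$ of colors to edges (not necessarily proper). For a vertex $v$, the color degree $\hat d(v)$ is the number of distinct colors that $c$ assigns to edges incident to $v$. The total color degree of $G$ is $\hat d(G)=\sum_{v\in V(G)}\hat d(v)$. A matching of size $k$ is a set of $k$ pairwise vertex-disjoint edges; it is rainbow if its edges receive pairwise distinct colors. *)

theory Defs
  imports Main
begin

text \<open>An edge is the two-element set of its endpoints, so loops and parallel edges cannot occur.\<close>

definition finite_simple_graph :: "'a set \<Rightarrow> 'a set set \<Rightarrow> bool" where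
  "finite_simple_graph V E \<longleftrightarrow> finite V \<and> (\<forall>e\<in>E. e \<subseteq> V \<and> card e = 2)"

text \<open>Three pairwise adjacent vertices are distinct, since no edge is a singleton.\<close>

definition triangle_free :: "'a set set \<Rightarrow> bool" where
  "triangle_free E \<longleftrightarrow> \<not> (\<exists>x y z. {x, y} \<in> E \<and> {y, z} \<in> E \<and> {x, z} \<in> E)"

text \<open>The values of \<open>c\<close> outside \<open>E\<close> are irrelevant; the colouring need not be proper.\<close>

definition edge_coloring :: "'a set set \<Rightarrow> nat \<Rightarrow> ('a set \<Rightarrow> nat) \<Rightarrow> bool" where
  "edge_coloring E r c \<longleftrightarrow> (\<forall>e\<in>E. c e \<in> {1..r})"

definition color_degree :: "'a set set \<Rightarrow> ('a set \<Rightarrow> nat) \<Rightarrow> 'a \<Rightarrow> nat" where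
  "color_degree E c v = card (c ` {e \<in> E. v \<in> e})"

definition total_color_degree :: "'a set \<Rightarrow> 'a set set \<Rightarrow> ('a set \<Rightarrow> nat) \<Rightarrow> nat" where
  "total_color_degree V E c = (\<Sum>v\<in>V. color_degree E c v)"

definition matching :: "'a set set \<Rightarrow> 'a set set \<Rightarrow> bool" where
  "matching E M \<longleftrightarrow> M \<subseteq> E \<and> pairwise disjnt M"

definition rainbow :: "('a set \<Rightarrow> nat) \<Rightarrow> 'a set set \<Rightarrow> bool" where
  "rainbow c M \<longleftrightarrow> inj_on c M"

end

(* Induct on m. Since the average color degree exceeds 2m, some vertex v has color degree at least
   2m+1. Deleting v costs v itself at most n-1 and every other vertex at most 1, so G-v still has
   total color degree greater than 2(m-1)(n-1) and contains a rainbow matching M of size m. By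
   triangle-freeness v has at most one neighbour on each edge of M, so at most m colors at v occur
   on edges from v to M, and at most m are colors of M: some edge at v extends M. *)
theory Submission
  imports Defs
begin

lemma edge_eq_insert:
  assumes "finite_simple_graph V E" "e \<in> E" "v \<in> e" "w \<in> e" "v \<noteq> w"
  shows "e = {v, w}"
  using assms unfolding finite_simple_graph_def by (auto simp: card_2_iff)

lemma finite_edges:
  assumes "finite_simple_graph V E"
  shows "finite E"
  using assms unfolding finite_simple_graph_def by (auto intro: finite_subset[of E "Pow V"])

lemma finite_simple_graph_delete_vertex:
  assumes "finite_simple_graph V E"
  shows "finite_simple_graph (V - {v}) {e \<in> E. v \<notin> e}"
  using assms unfolding finite_simple_graph_def by auto

lemma triangle_free_subset:
  assumes "triangle_free E" "E' \<subseteq> E"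
  shows "triangle_free E'"
  using assms unfolding triangle_free_def by blast

text \<open>In a simple graph every edge at \<open>v\<close> is determined by its other endpoint, so
  the colors at \<open>v\<close> form part of the image of \<open>V - {v}\<close>.\<close>

lemma color_degree_le_order:
  assumes G: "finite_simple_graph V E" and v: "v \<in> V"
  shows "color_degree E c v \<le> card V - 1"
proof -
  have fin: "finite V" using G by (simp add: finite_simple_graph_def)
  have "{e \<in> E. v \<in> e} \<subseteq> (\<lambda>w. {v, w}) ` (V - {v})"
  proof
    fix e assume e: "e \<in> {e \<in> E. v \<in> e}"
    then have "card e = 2" "e \<subseteq> V" using G by (auto simp: finite_simple_graph_def)
    then obtain w where "w \<in> e" "w \<noteq> v" by (auto simp: card_2_iff)
    with e \<open>e \<subseteq> V\<close> edge_eq_insert[OF G, of e v w] show "e \<in> (\<lambda>w. {v, w}) ` (V - {v})"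
      by auto
  qed
  then have "c ` {e \<in> E. v \<in> e} \<subseteq> (\<lambda>w. c {v, w}) ` (V - {v})" by fastforce
  then have "color_degree E c v \<le> card (V - {v})"
    unfolding color_degree_def using fin by (meson finite_Diff surj_card_le)
  with fin v show ?thesis by simp
qed

text \<open>The only edge that \<open>w\<close> can lose is \<open>{v, w}\<close>, and its color may
  still recur on other edges at \<open>w\<close>.\<close>

lemma color_degree_delete_vertex:
  assumes G: "finite_simple_graph V E" and "w \<noteq> v"
  shows "color_degree E c w \<le> color_degree {e \<in> E. v \<notin> e} c w + 1"
proof -
  let ?S = "c ` {e \<in> {e \<in> E. v \<notin> e}. w \<in> e}"
  have "c ` {e \<in> E. w \<in> e} \<subseteq> insert (c {v, w}) ?S"
    using edge_eq_insert[OF G, of _ v w] assms(2) by auto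
  moreover have "finite ?S" using finite_edges[OF G] by simp
  ultimately have "card (c ` {e \<in> E. w \<in> e}) \<le> card (insert (c {v, w}) ?S)"
    by (intro card_mono) auto
  also have "\<dots> \<le> card ?S + 1" using \<open>finite ?S\<close> by (simp only: card_insert_if) simp
  finally show ?thesis by (simp add: color_degree_def)
qed

text \<open>One \<open>card V - 1\<close> pays for the color degree of \<open>v\<close> itself, the
  other for one color at each remaining vertex.\<close>

lemma total_color_degree_delete_vertex:
  assumes G: "finite_simple_graph V E" and v: "v \<in> V"
  shows "total_color_degree V E c
    \<le> total_color_degree (V - {v}) {e \<in> E. v \<notin> e} c + 2 * (card V - 1)"
proof -
  have fin: "finite V" using G by (simp add: finite_simple_graph_def)
  have "(\<Sum>w\<in>V - {v}. color_degree E c w)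
      \<le> (\<Sum>w\<in>V - {v}. color_degree {e \<in> E. v \<notin> e} c w + 1)"
    by (intro sum_mono color_degree_delete_vertex[OF G]) simp
  also have "\<dots> = total_color_degree (V - {v}) {e \<in> E. v \<notin> e} c + (card V - 1)"
    using fin v by (simp only: sum.distrib total_color_degree_def) simp
  finally show ?thesis
    using color_degree_le_order[OF G v, of c]
    by (simp add: total_color_degree_def sum.remove[OF fin v])
qed

lemma color_degree_gt_average:
  assumes "finite V" "total_color_degree V E c > k * card V"
  obtains v where "v \<in> V" "color_degree E c v > k"
proof -
  have "\<not> (\<forall>v\<in>V. color_degree E c v \<le> k)"
    using assms sum_bounded_above[of V "color_degree E c" k]
    by (auto simp: total_color_degree_def mult.commute)
  then show ?thesis using that by force
qed

text \<open>Edges from \<open>v\<close> to both ends of \<open>f\<close> would close a triangle with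
  \<open>f\<close>.\<close>

lemma triangle_free_edges_to_edge:
  assumes G: "finite_simple_graph V E" and T: "triangle_free E"
    and f: "f \<in> E" "v \<notin> f"
  shows "card {e \<in> E. v \<in> e \<and> e \<inter> f \<noteq> {}} \<le> 1"
proof -
  have "e1 = e2" if e: "e1 \<in> E" "v \<in> e1" "x \<in> e1" "x \<in> f" "e2 \<in> E" "v \<in> e2" "y \<in> e2" "y \<in> f"
    for e1 e2 x y
  proof -
    have "v \<noteq> x" "v \<noteq> y" using e f by auto
    then have eq: "e1 = {v, x}" "e2 = {v, y}" using e edge_eq_insert[OF G] by auto
    have "x = y"
    proof (rule ccontr)
      assume "x \<noteq> y"
      then have "f = {x, y}" using e f edge_eq_insert[OF G] by auto
      then show False using T e f eq unfolding triangle_free_def by blast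
    qed
    then show ?thesis using eq by simp
  qed
  then show ?thesis
    using finite_edges[OF G] by (auto simp: card_le_Suc0_iff_eq)
qed

lemma rainbow_matching_extend:
  assumes G: "finite_simple_graph V E" and T: "triangle_free E"
    and M: "matching {e \<in> E. v \<notin> e} M" "rainbow c M"
    and deg: "color_degree E c v > 2 * card M"
  shows "\<exists>M'. matching E M' \<and> rainbow c M' \<and> card M' = card M + 1"
proof -
  \<comment> \<open>\<open>F\<close> collects the edges at \<open>v\<close> that meet
    \<open>M\<close>; each edge of \<open>M\<close> contributes at most one of them.\<close>
  define F where "F = (\<Union>f\<in>M. {e \<in> E. v \<in> e \<and> e \<inter> f \<noteq> {}})"
  have sub: "M \<subseteq> {e \<in> E. v \<notin> e}" using M by (simp add: matching_def)
  have finM: "finite M" using sub finite_edges[OF G] by (auto intro: finite_subset)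
  have finF: "finite F" unfolding F_def using finM finite_edges[OF G] by auto
  have "card F \<le> (\<Sum>f\<in>M. card {e \<in> E. v \<in> e \<and> e \<inter> f \<noteq> {}})"
    unfolding F_def by (rule card_UN_le[OF finM])
  also have "\<dots> \<le> (\<Sum>f\<in>M. 1)"
    using sub by (intro sum_mono triangle_free_edges_to_edge[OF G T]) auto
  finally have "card (c ` F) \<le> card M" using card_image_le[OF finF, of c] by simp
  moreover have "card (c ` M) \<le> card M" using finM by (rule card_image_le)
  ultimately have "card (c ` F \<union> c ` M) < card (c ` {e \<in> E. v \<in> e})"
    using deg card_Un_le[of "c ` F" "c ` M"] by (simp add: color_degree_def)
  then have "\<not> c ` {e \<in> E. v \<in> e} \<subseteq> c ` F \<union> c ` M"
    using finF finM by (meson card_mono finite_UnI finite_imageI not_less)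
  \<comment> \<open>A color outside \<open>c\<close>
    F\<open>forces\<close>e\<open>outside\<close>F\<open>, which makes\<close>e\<open>disjoint from\<close>M\<open>; a color outside\<close>c
    \<open>M\<close> keeps the matching rainbow.\<close>
  then obtain e where e: "e \<in> E" "v \<in> e" "c e \<notin> c ` F" "c e \<notin> c ` M" by auto
  have "disjnt e f" if "f \<in> M" for f
    using e that by (auto simp: F_def disjnt_def)
  then have "matching E (insert e M)"
    using M e sub by (auto simp: matching_def pairwise_insert disjnt_sym)
  moreover have "rainbow c (insert e M)"
    using M e by (auto simp: rainbow_def)
  moreover have "card (insert e M) = card M + 1"
    using e finM by (subst card_insert_disjoint) auto
  ultimately show ?thesis by blast
qed

theorem theorem1:
  fixes V :: "'a set" and E :: "'a set set" and c :: "'a set \<Rightarrow> nat" and m n r :: nat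
  assumes "finite_simple_graph V E"
    and "triangle_free E"
    and "card V = n"
    and "edge_coloring E r c"
    and "total_color_degree V E c > 2 * m * n"
  shows "\<exists>M. matching E M \<and> rainbow c M \<and> card M = m + 1"
proof -
  have "2 * m * card V < total_color_degree V E c" using assms by simp
  with assms(1,2) show ?thesis
  \<comment> \<open>The coloring stays fixed, while the graph varies because the hypothesis is
    applied after deleting a vertex; with \<open>card V\<close> in place of \<open>n\<close>, the
    order shrinks along.\<close>
  proof (induction m arbitrary: V E)
    case (0 V E)
    have "finite V" using 0 by (simp add: finite_simple_graph_def)
    then obtain v where "color_degree E c v > 0"
      using color_degree_gt_average[of V 0 E c] 0 by auto
    \<comment> \<open>The empty matching is extended by one edge at \<open>v\<close>.\<close>
    then show ?case
      using rainbow_matching_extend[OF 0(1,2), of v "{}" c]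
      by (simp add: matching_def rainbow_def)
  next
    case (Suc m V E)
    have fin: "finite V" using Suc.prems by (simp add: finite_simple_graph_def)
    obtain v where v: "v \<in> V" "color_degree E c v > 2 * Suc m"
      using color_degree_gt_average[OF fin] Suc.prems(3) by metis
    \<comment> \<open>The first summand is the bound required for the smaller graph, the second the
      most that the deletion costs. The left side is \<open>2 * Suc m * (card V - 1)\<close>; the
      case split deals with truncated subtraction.\<close>
    have "2 * m * (card V - 1) + 2 * (card V - 1) \<le> 2 * Suc m * card V"
      by (cases "card V") (auto simp: algebra_simps)
    then have less: "2 * m * card (V - {v}) < total_color_degree (V - {v}) {e \<in> E. v \<notin> e} c"
      using total_color_degree_delete_vertex[OF Suc.prems(1) v(1), of c] Suc.prems(3) fin v(1)
      by simp
    obtain M where M: "matching {e \<in> E. v \<notin> e} M" "rainbow c M" "card M = Suc m"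
      using Suc.IH[OF finite_simple_graph_delete_vertex[OF Suc.prems(1)]
        triangle_free_subset[OF Suc.prems(2)] less] by auto
    \<comment> \<open>Since \<open>card M = Suc m\<close>, the color degree of \<open>v\<close> in
      the undeleted graph exceeds \<open>2 * card M\<close>.\<close>
    then show ?case
      using rainbow_matching_extend[OF Suc.prems(1,2) M(1,2)] v(2) by simp
  qed
qed

end
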